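(* Consider the $N$-partite GHZ state $|\mathrm{GHZ}_N(\alpha)\rangle=\alpha|0\rangle^{\otimes N}+\sqrt{1-\alpha^2}\,|1\rangle^{\otimes N}$, $0<\alpha<1$, undergoing the local beam-splitter broadcasting protocol with reflectivity $R$. Its transmitted copy fidelity is $$\mathcal{F}_t^{(N)}(\alpha,R)=\frac{P_t^{(N)}(\alpha,R)}{\left(R^2-R+\tfrac13\right)^N},$$ where $P_t^{(N)}(\alpha,R)$ is a polynomial of degree $2N$ in $R$. The fidelity decays exponentially: $$\mathcal{F}_t^{(N)}(R)\sim\left[c_{\mathrm{GHZ}}(R)\right]^N,\qquad N\to\infty,$$ with $c_{\mathrm{GHZ}}(0)=1$ and $c_{\mathrm{GHZ}}(1/2)=1/2$. Here $\mathcal{F}_t^{(N)}(R)$ is the transmitted copy fidelity with the argument $\alpha$ not displayed, and $c_{\mathrm{GHZ}}(R)$ denotes the per-party degradation factor of the fidelity, a function of $R$.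
   Context: Local beam-splitter broadcasting protocol with reflectivity $R$ (transmissivity $1-R$). Let $|\Phi_N\rangle$ be an $N$-qubit unit vector on qubits $1,\dots,N$. For each $j=1,\dots,N$ take an ancillary pair of qubits $a_j,b_j$ in the state $|\chi_j\rangle_{a_jb_j}=\frac{1}{\sqrt2}(|01\rangle-|10\rangle)$ (symmetric broadcasting). The initial state on $3N$ qubits is $|\Psi_{\rm in}\rangle=|\Phi_N\rangle_{1\dots N}\otimes\bigotimes_{j=1}^N|\chi_j\rangle_{a_jb_j}$. Let $S_{j,a_j}$ be the swap operator exchanging qubits $j$ and $a_j$, and let $U_j=(1-R)\,\mathbf{1}-R\,S_{j,a_j}$ (the post-selected beam-splitter map of party $j$). The unnormalised output is $|\Psi_{\rm out}\rangle=\left(\prod_{j=1}^N U_j\right)|\Psi_{\rm in}\rangle$. Let $\rho_t$ be the partial trace of $|\Psi_{\rm out}\rangle\langle\Psi_{\rm out}|$ over all qubits $a_j,b_j$, so that $\rho_t$ acts on qubits $1,\dots,N$. The transmitted copy fidelity is $$\mathcal{F}_t^{(N)}=\frac{\langle\Phi_N|\rho_t|\Phi_N\rangle}{\langle\Psi_{\rm out}|\Psi_{\rm out}\rangle}.$$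
   Formalization: The decay law is stated as F ~ C·[c_GHZ(R)]^N with a positive prefactor C depending on α and R but not on N; without the prefactor it fails, e.g. at α² = 1/2, R = 1/4 the ratio tends to 1/2. *)

theory Defs
  imports
    "HOL-Analysis.Analysis"
    "HOL-Library.Landau_Symbols"
    "HOL-Computational_Algebra.Polynomial"
begin

text \<open>
  A register is a finite set of qubit labels. Its computational basis consists of the extensional
  functions from the labels to bits (\<open>False\<close> is the bit 0, \<open>True\<close> the bit 1). A vector
  is given by its amplitudes and an operator by its matrix entries (row first) in that basis; only
  the values on basis labels are meaningful.
\<close>

type_synonym 'q ket = "('q \<Rightarrow> bool) \<Rightarrow> complex"
type_synonym 'q operator = "('q \<Rightarrow> bool) \<Rightarrow> ('q \<Rightarrow> bool) \<Rightarrow> complex"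

definition comp_basis :: "'q set \<Rightarrow> ('q \<Rightarrow> bool) set" where
  "comp_basis Q = Q \<rightarrow>\<^sub>E (UNIV :: bool set)"

definition basis_ket :: "('q \<Rightarrow> bool) \<Rightarrow> 'q ket" where
  "basis_ket y = (\<lambda>x. if x = y then 1 else 0)"

definition braket :: "'q set \<Rightarrow> 'q ket \<Rightarrow> 'q ket \<Rightarrow> complex" where
  "braket Q \<phi> \<psi> = (\<Sum>x\<in>comp_basis Q. cnj (\<phi> x) * \<psi> x)"

definition ketbra :: "'q ket \<Rightarrow> 'q ket \<Rightarrow> 'q operator" where
  "ketbra \<phi> \<psi> = (\<lambda>x y. \<phi> x * cnj (\<psi> y))"

definition apply_op :: "'q set \<Rightarrow> 'q operator \<Rightarrow> 'q ket \<Rightarrow> 'q ket" where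
  "apply_op Q A \<psi> = (\<lambda>x. \<Sum>y\<in>comp_basis Q. A x y * \<psi> y)"

text \<open>Trace over the register \<open>E\<close> of an operator on the disjoint union of \<open>Q\<close> and \<open>E\<close>.\<close>

definition partial_trace :: "'q set \<Rightarrow> 'q set \<Rightarrow> 'q operator \<Rightarrow> 'q operator" where
  "partial_trace Q E \<rho> =
     (\<lambda>x y. \<Sum>z\<in>comp_basis E. \<rho> (merge Q E (x, z)) (merge Q E (y, z)))"

definition swap_qubits :: "'q \<Rightarrow> 'q \<Rightarrow> 'q ket \<Rightarrow> 'q ket" where
  "swap_qubits q r \<psi> = (\<lambda>x. \<psi> (x(q := x r, r := x q)))"

text \<open>\<open>Sys j\<close> is qubit \<open>j\<close>; \<open>AncA j\<close> and \<open>AncB j\<close> are the ancillas \<open>a\<^sub>j\<close> and \<open>b\<^sub>j\<close>.\<close>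

datatype qubit = Sys nat | AncA nat | AncB nat

definition sys :: "nat \<Rightarrow> qubit set" where
  "sys N = Sys ` {1..N}"

definition anc :: "nat \<Rightarrow> qubit set" where
  "anc N = AncA ` {1..N} \<union> AncB ` {1..N}"

definition singlet :: "nat \<Rightarrow> qubit ket" where
  "singlet j = (\<lambda>x.
     (basis_ket (\<lambda>q\<in>{AncA j, AncB j}. q = AncB j) x
      - basis_ket (\<lambda>q\<in>{AncA j, AncB j}. q = AncA j) x) / complex_of_real (sqrt 2))"

definition initial_state :: "nat \<Rightarrow> qubit ket \<Rightarrow> qubit ket" where
  "initial_state N \<Phi> = (\<lambda>x.
     \<Phi> (restrict x (sys N)) * (\<Prod>j=1..N. singlet j (restrict x {AncA j, AncB j})))"

definition beam_splitter :: "real \<Rightarrow> nat \<Rightarrow> qubit ket \<Rightarrow> qubit ket" where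
  "beam_splitter R j \<psi> = (\<lambda>x.
     complex_of_real (1 - R) * \<psi> x - complex_of_real R * swap_qubits (Sys j) (AncA j) \<psi> x)"

text \<open>The maps of different parties commute, so the order in the product is immaterial.\<close>

definition output_state :: "nat \<Rightarrow> real \<Rightarrow> qubit ket \<Rightarrow> qubit ket" where
  "output_state N R \<Phi> = foldr (beam_splitter R) [1..<Suc N] (initial_state N \<Phi>)"

definition transmitted_state :: "nat \<Rightarrow> real \<Rightarrow> qubit ket \<Rightarrow> qubit operator" where
  "transmitted_state N R \<Phi> =
     partial_trace (sys N) (anc N) (ketbra (output_state N R \<Phi>) (output_state N R \<Phi>))"

text \<open>Numerator and denominator are both real; \<open>Re\<close> only changes the type.\<close>

definition transmitted_fidelity :: "nat \<Rightarrow> real \<Rightarrow> qubit ket \<Rightarrow> real" where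
  "transmitted_fidelity N R \<Phi> =
     Re (braket (sys N) \<Phi> (apply_op (sys N) (transmitted_state N R \<Phi>) \<Phi>)
         / braket (sys N \<union> anc N) (output_state N R \<Phi>) (output_state N R \<Phi>))"

definition GHZ :: "nat \<Rightarrow> real \<Rightarrow> qubit ket" where
  "GHZ N \<alpha> = (\<lambda>x.
     complex_of_real \<alpha> * basis_ket (\<lambda>q\<in>sys N. False) x
     + complex_of_real (sqrt (1 - \<alpha>\<^sup>2)) * basis_ket (\<lambda>q\<in>sys N. True) x)"

definition GHZ_fidelity :: "nat \<Rightarrow> real \<Rightarrow> real \<Rightarrow> real" where
  "GHZ_fidelity N \<alpha> R = transmitted_fidelity N R (GHZ N \<alpha>)"

end

theory Submission
  imports Defs
begin

text \<open>
  Written in the basis of the ancillas, each party acts on its system qubit through four Kraus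
  operators: two diagonal ones, \<open>diag (1 - 2 * R, 1 - R) / sqrt 2\<close> and
  \<open>- diag (1 - R, 1 - 2 * R) / sqrt 2\<close>, and two off-diagonal ones with a single entry
  \<open>R / sqrt 2\<close> up to sign. Norm and overlap of the output are sums of products over the
  ancilla outcomes of the parties, hence \<open>N\<close>-th powers of single-party sums. With
  \<open>A = (2 - 6 * R + 5 * R\<^sup>2) / 2\<close>, \<open>B = (1 - 2 * R) * (1 - R)\<close> and \<open>\<beta>\<^sup>2 = 1 - \<alpha>\<^sup>2\<close>, the fidelity is
  \<open>((\<alpha>^4 + \<beta>^4) * A ^ N + 2 * \<alpha>\<^sup>2 * \<beta>\<^sup>2 * (B ^ N + (R\<^sup>2 / 2) ^ N)) / (3 * R\<^sup>2 - 3 * R + 1) ^ N\<close>.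
  Since \<open>A - R\<^sup>2 / 2 = B\<close> and \<open>\<bar>B\<bar> \<le> A\<close>, the dominant base is \<open>max A (R\<^sup>2 / 2)\<close>, which switches from
  the diagonal to the off-diagonal contribution at \<open>R = 1 / 2\<close>.
\<close>

section \<open>Evolution of the parties as independent factors\<close>

definition singlet_amp :: "bool \<Rightarrow> bool \<Rightarrow> real" where
  "singlet_amp a b = (of_bool (\<not> a \<and> b) - of_bool (a \<and> \<not> b)) / sqrt 2"

text \<open>The matrix entry in row \<open>s\<close> and column \<open>t\<close> of the Kraus operator for the outcome \<open>(a, b)\<close>.\<close>

definition kraus :: "real \<Rightarrow> bool \<Rightarrow> bool \<Rightarrow> bool \<Rightarrow> bool \<Rightarrow> real" where
  "kraus R t s a b = (1 - R) * (of_bool (s = t) * singlet_amp a b)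
     - R * (of_bool (a = t) * singlet_amp s b)"

text \<open>Kets of this shape are closed under every \<open>beam_splitter\<close>, which acts on a
  single factor. The initial state is a combination of two of them, one per branch of the GHZ
  state.\<close>

definition product_ket :: "nat \<Rightarrow> (nat \<Rightarrow> bool \<Rightarrow> bool \<Rightarrow> bool \<Rightarrow> real) \<Rightarrow> qubit ket" where
  "product_ket N g x =
     complex_of_real (\<Prod>j=1..N. g j (x (Sys j)) (x (AncA j)) (x (AncB j)))"

lemma singlet_restrict:
  "singlet j (restrict x {AncA j, AncB j})
     = complex_of_real (singlet_amp (x (AncA j)) (x (AncB j)))"
proof -
  have "restrict x {AncA j, AncB j} = (\<lambda>q\<in>{AncA j, AncB j}. q = AncB j)
      \<longleftrightarrow> \<not> x (AncA j) \<and> x (AncB j)"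
    "restrict x {AncA j, AncB j} = (\<lambda>q\<in>{AncA j, AncB j}. q = AncA j)
      \<longleftrightarrow> x (AncA j) \<and> \<not> x (AncB j)"
    by (auto simp: fun_eq_iff restrict_def)
  then show ?thesis
    by (simp add: singlet_def basis_ket_def singlet_amp_def)
qed

lemma prod_of_bool:
  "finite A \<Longrightarrow> (\<Prod>j\<in>A. of_bool (P j) :: 'a :: {comm_semiring_1, semiring_no_zero_divisors})
     = of_bool (\<forall>j\<in>A. P j)"
  by (induction A rule: finite_induct) auto

lemma basis_ket_restrict_sys:
  "basis_ket (\<lambda>q\<in>sys N. t) (restrict x (sys N))
     = complex_of_real (\<Prod>j=1..N. of_bool (x (Sys j) = t))"
proof -
  have "restrict x (sys N) = (\<lambda>q\<in>sys N. t) \<longleftrightarrow> (\<forall>j\<in>{1..N}. x (Sys j) = t)"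
    by (auto simp: fun_eq_iff restrict_def sys_def)
  then show ?thesis
    by (simp add: basis_ket_def prod_of_bool)
qed

lemma initial_state_GHZ:
  "initial_state N (GHZ N \<alpha>) = (\<lambda>x.
     complex_of_real \<alpha> * product_ket N (\<lambda>j s a b. of_bool (s = False) * singlet_amp a b) x
     + complex_of_real (sqrt (1 - \<alpha>\<^sup>2))
       * product_ket N (\<lambda>j s a b. of_bool (s = True) * singlet_amp a b) x)"
  unfolding initial_state_def GHZ_def basis_ket_restrict_sys singlet_restrict product_ket_def
  by (simp only: prod.distrib of_real_prod of_real_mult distrib_right mult.assoc)

lemma beam_splitter_linear:
  "beam_splitter R j (\<lambda>x. c * \<phi> x + d * \<psi> x)
     = (\<lambda>x. c * beam_splitter R j \<phi> x + d * beam_splitter R j \<psi> x)"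
  by (rule ext) (simp add: beam_splitter_def swap_qubits_def algebra_simps)

lemma foldr_beam_splitter_linear:
  "foldr (beam_splitter R) js (\<lambda>x. c * \<phi> x + d * \<psi> x)
     = (\<lambda>x. c * foldr (beam_splitter R) js \<phi> x + d * foldr (beam_splitter R) js \<psi> x)"
  by (induction js) (simp_all add: beam_splitter_linear)

text \<open>The swap moves only the bits \<open>x (Sys k)\<close> and \<open>x (AncA k)\<close>,
  which occur in factor \<open>k\<close> alone, so it just exchanges the first two arguments of
  \<open>g k\<close>.\<close>

lemma beam_splitter_product_ket:
  assumes "k \<in> {1..N}"
  shows "beam_splitter R k (product_ket N g)
    = product_ket N (g(k := (\<lambda>s a b. (1 - R) * g k s a b - R * g k a s b)))"
proof (rule ext)
  fix x
  have split: "(\<Prod>j=1..N. f j) = f k * (\<Prod>j\<in>{1..N} - {k}. f j)" for f :: "nat \<Rightarrow> real"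
    using assms by (intro prod.remove) auto
  have 1: "(\<Prod>j\<in>{1..N} - {k}. (g(k := h)) j (x (Sys j)) (x (AncA j)) (x (AncB j)))
     = (\<Prod>j\<in>{1..N} - {k}. g j (x (Sys j)) (x (AncA j)) (x (AncB j)))" for h
    by (rule prod.cong) auto
  have 2: "(\<Prod>j\<in>{1..N} - {k}. g j ((x(Sys k := x (AncA k), AncA k := x (Sys k))) (Sys j))
        ((x(Sys k := x (AncA k), AncA k := x (Sys k))) (AncA j))
        ((x(Sys k := x (AncA k), AncA k := x (Sys k))) (AncB j)))
     = (\<Prod>j\<in>{1..N} - {k}. g j (x (Sys j)) (x (AncA j)) (x (AncB j)))"
    by (rule prod.cong) auto
  show "beam_splitter R k (product_ket N g) x
    = product_ket N (g(k := (\<lambda>s a b. (1 - R) * g k s a b - R * g k a s b))) x"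
    unfolding beam_splitter_def swap_qubits_def product_ket_def split 1 2
    by (simp add: algebra_simps)
qed

text \<open>Distinctness guarantees that factor \<open>k\<close> is still the original
  \<open>g k\<close> when party \<open>k\<close> acts on it.\<close>

lemma foldr_beam_splitter_product_ket:
  assumes "distinct js" "set js \<subseteq> {1..N}"
  shows "foldr (beam_splitter R) js (product_ket N g)
    = product_ket N (\<lambda>j. if j \<in> set js then (\<lambda>s a b. (1 - R) * g j s a b - R * g j a s b) else g j)"
  using assms
proof (induction js)
  case (Cons k js)
  then show ?case
    by (auto simp: beam_splitter_product_ket intro!: arg_cong[where f = "product_ket N"])
qed simp

lemma output_state_GHZ:
  "output_state N R (GHZ N \<alpha>) = (\<lambda>x. complex_of_real
     (\<alpha> * (\<Prod>j=1..N. kraus R False (x (Sys j)) (x (AncA j)) (x (AncB j)))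
      + sqrt (1 - \<alpha>\<^sup>2) * (\<Prod>j=1..N. kraus R True (x (Sys j)) (x (AncA j)) (x (AncB j)))))"
proof -
  \<comment> \<open>Outside \<open>{1..N}\<close> the two families of factors differ, but
    \<open>product_ket N\<close> never reads them there.\<close>
  have evolved: "foldr (beam_splitter R) [1..<Suc N]
        (product_ket N (\<lambda>j s a b. of_bool (s = t) * singlet_amp a b))
      = product_ket N (\<lambda>j. kraus R t)" for t
    by (subst foldr_beam_splitter_product_ket)
      (auto simp: product_ket_def kraus_def fun_eq_iff simp del: upt_Suc intro!: prod.cong)
  show ?thesis
    unfolding output_state_def initial_state_GHZ foldr_beam_splitter_linear evolved
    by (simp only: product_ket_def of_real_add of_real_mult)
qed

section \<open>Sums over basis labels as powers of single-party sums\<close>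

lemma finite_comp_basis [simp]: "finite Q \<Longrightarrow> finite (comp_basis Q)"
  by (simp add: comp_basis_def finite_PiE)

lemma finite_sys [simp]: "finite (sys N)"
  by (simp add: sys_def)

text \<open>A basis label of the whole register is the same as a choice of three bits for each
  party; \<open>dec\<close> is this bijection. Distributing the product over the sums then gives
  equal factors.\<close>

lemma sum_comp_basis_prod:
  fixes f :: "bool \<Rightarrow> bool \<Rightarrow> bool \<Rightarrow> real"
  shows "(\<Sum>x\<in>comp_basis (sys N \<union> anc N). \<Prod>j=1..N. f (x (Sys j)) (x (AncA j)) (x (AncB j)))
    = (\<Sum>(s, a, b)\<in>UNIV. f s a b) ^ N"
proof -
  define dec where "dec g = (\<lambda>q\<in>sys N \<union> anc N. case q of
      Sys j \<Rightarrow> fst (g j) | AncA j \<Rightarrow> fst (snd (g j)) | AncB j \<Rightarrow> snd (snd (g j)))"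
    for g :: "nat \<Rightarrow> bool \<times> bool \<times> bool"
  have dec_inverse: "dec (\<lambda>j\<in>{1..N}. (x (Sys j), x (AncA j), x (AncB j))) = x" if "x \<in> comp_basis (sys N \<union> anc N)" for x
    by (rule extensionalityI[of _ "sys N \<union> anc N"])
      (use that in \<open>auto simp: dec_def comp_basis_def sys_def anc_def PiE_iff\<close>)
  have "(\<Sum>(s, a, b)\<in>UNIV. f s a b) ^ N = (\<Prod>j=1..N. \<Sum>(s, a, b)\<in>UNIV. f s a b)"
    by simp
  also have "\<dots> = (\<Sum>g\<in>{1..N} \<rightarrow>\<^sub>E UNIV. \<Prod>j=1..N. case g j of (s, a, b) \<Rightarrow> f s a b)"
    by (rule prod_sum_PiE) auto
  also have "\<dots> = (\<Sum>x\<in>comp_basis (sys N \<union> anc N).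
      \<Prod>j=1..N. f (x (Sys j)) (x (AncA j)) (x (AncB j)))"
    by (rule sum.reindex_bij_witness[where i = "\<lambda>x. \<lambda>j\<in>{1..N}. (x (Sys j), x (AncA j), x (AncB j))"
          and j = dec])
      (simp_all add: dec_inverse, auto simp: dec_def comp_basis_def sys_def anc_def fun_eq_iff
        PiE_iff extensional_def case_prod_unfold)
  finally show ?thesis ..
qed

lemma sum_comp_basis_anc_prod:
  fixes f :: "bool \<Rightarrow> bool \<Rightarrow> real"
  shows "(\<Sum>x\<in>comp_basis (anc N). \<Prod>j=1..N. f (x (AncA j)) (x (AncB j)))
    = (\<Sum>(a, b)\<in>UNIV. f a b) ^ N"
proof -
  \<comment> \<open>The \<open>undefined\<close> case is a filler: no \<open>Sys j\<close> lies in
    \<open>anc N\<close>.\<close>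
  define dec where "dec g = (\<lambda>q\<in>anc N. case q of
      Sys j \<Rightarrow> undefined | AncA j \<Rightarrow> fst (g j) | AncB j \<Rightarrow> snd (g j))"
    for g :: "nat \<Rightarrow> bool \<times> bool"
  have dec_inverse: "dec (\<lambda>j\<in>{1..N}. (x (AncA j), x (AncB j))) = x" if "x \<in> comp_basis (anc N)" for x
    by (rule extensionalityI[of _ "anc N"])
      (use that in \<open>auto simp: dec_def comp_basis_def sys_def anc_def PiE_iff\<close>)
  have "(\<Sum>(a, b)\<in>UNIV. f a b) ^ N = (\<Prod>j=1..N. \<Sum>(a, b)\<in>UNIV. f a b)"
    by simp
  also have "\<dots> = (\<Sum>g\<in>{1..N} \<rightarrow>\<^sub>E UNIV. \<Prod>j=1..N. case g j of (a, b) \<Rightarrow> f a b)"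
    by (rule prod_sum_PiE) auto
  also have "\<dots> = (\<Sum>x\<in>comp_basis (anc N). \<Prod>j=1..N. f (x (AncA j)) (x (AncB j)))"
    by (rule sum.reindex_bij_witness[where i = "\<lambda>x. \<lambda>j\<in>{1..N}. (x (AncA j), x (AncB j))"
          and j = dec])
      (simp_all add: dec_inverse, auto simp: dec_def comp_basis_def sys_def anc_def fun_eq_iff
        PiE_iff extensional_def case_prod_unfold)
  finally show ?thesis ..
qed

section \<open>Norm and overlap of the output\<close>

lemma sum_UNIV_bool_pair:
  fixes f :: "bool \<Rightarrow> bool \<Rightarrow> real"
  shows "(\<Sum>(a, b)\<in>UNIV. f a b) = f False False + f False True + f True False + f True True"
  unfolding UNIV_Times_UNIV[symmetric] sum.cartesian_product[symmetric] UNIV_bool by simp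

lemma sum_UNIV_bool_triple:
  fixes f :: "bool \<Rightarrow> bool \<Rightarrow> bool \<Rightarrow> real"
  shows "(\<Sum>(s, a, b)\<in>UNIV. f s a b) = (\<Sum>(a, b)\<in>UNIV. f False a b) + (\<Sum>(a, b)\<in>UNIV. f True a b)"
proof -
  have "(\<Sum>(s, a, b)\<in>UNIV. f s a b) = (\<Sum>s\<in>UNIV. \<Sum>(a, b)\<in>UNIV. f s a b)"
    by (subst sum.cartesian_product) (simp add: case_prod_unfold)
  then show ?thesis
    by (simp add: UNIV_bool)
qed

text \<open>Swapping preserves the number of ones and the singlet contains exactly one, so an entry
  can be nonzero only if \<open>s + a + b = t + 1\<close> as integers. This leaves three entries for
  each input bit.\<close>

lemma kraus_simps:
  "kraus R False False False False = 0" "kraus R False False False True = (1 - 2 * R) / sqrt 2"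
  "kraus R False False True False = - (1 - R) / sqrt 2" "kraus R False False True True = 0"
  "kraus R False True False False = R / sqrt 2" "kraus R False True False True = 0"
  "kraus R False True True False = 0" "kraus R False True True True = 0"
  "kraus R True True False False = 0" "kraus R True True False True = (1 - R) / sqrt 2"
  "kraus R True True True False = - (1 - 2 * R) / sqrt 2" "kraus R True True True True = 0"
  "kraus R True False False False = 0" "kraus R True False False True = 0"
  "kraus R True False True False = 0" "kraus R True False True True = - R / sqrt 2"
  by (simp_all add: kraus_def singlet_amp_def diff_divide_distrib)

text \<open>The two branches have the same norm and are orthogonal, since different input bits lead
  to different numbers of ones. With \<open>\<alpha>\<^sup>2 + \<beta>\<^sup>2 = 1\<close> the
  dependence on \<open>\<alpha>\<close> disappears.\<close>

lemma norm_output_GHZ: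
  assumes "\<bar>\<alpha>\<bar> \<le> 1" "N \<ge> 1"
  shows "braket (sys N \<union> anc N) (output_state N R (GHZ N \<alpha>)) (output_state N R (GHZ N \<alpha>))
    = complex_of_real ((3 * R\<^sup>2 - 3 * R + 1) ^ N)"
proof -
  define \<beta> where "\<beta> = sqrt (1 - \<alpha>\<^sup>2)"
  have \<beta>: "\<beta>\<^sup>2 = 1 - \<alpha>\<^sup>2"
    using assms by (simp add: \<beta>_def abs_square_le_1)
  define K where "K t x = (\<Prod>j=1..N. kraus R t (x (Sys j)) (x (AncA j)) (x (AncB j)))" for t x
  let ?D = "3 * R\<^sup>2 - 3 * R + 1" and ?X = "comp_basis (sys N \<union> anc N)"
  have "(\<Sum>x\<in>?X. K t x * K u x)
      = (\<Sum>(s, a, b)\<in>UNIV. kraus R t s a b * kraus R u s a b) ^ N" for t u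
    unfolding K_def prod.distrib[symmetric]
    by (rule sum_comp_basis_prod[where f = "\<lambda>s a b. kraus R t s a b * kraus R u s a b"])
  moreover have "(\<Sum>(s, a, b)\<in>UNIV. kraus R t s a b * kraus R u s a b)
      = (if t = u then ?D else 0)" for t u
    unfolding sum_UNIV_bool_triple sum_UNIV_bool_pair
    by (cases t; cases u) (simp_all add: kraus_simps field_simps power2_eq_square)
  \<comment> \<open>The cross term is \<open>0 ^ N\<close>, which vanishes because
    \<open>N \<ge> 1\<close>.\<close>
  ultimately have gram: "(\<Sum>x\<in>?X. K t x * K u x) = (if t = u then ?D ^ N else 0)" for t u
    using assms by simp
  have "(\<Sum>x\<in>?X. (\<alpha> * K False x + \<beta> * K True x)\<^sup>2)
      = (\<Sum>x\<in>?X. \<alpha>\<^sup>2 * (K False x * K False x) + 2 * \<alpha> * \<beta> * (K False x * K True x)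
          + \<beta>\<^sup>2 * (K True x * K True x))"
    by (rule sum.cong) (auto simp: algebra_simps power2_eq_square)
  also have "\<dots> = \<alpha>\<^sup>2 * ?D ^ N + \<beta>\<^sup>2 * ?D ^ N"
    by (simp only: sum.distrib sum_distrib_left[symmetric] gram) simp
  also have "\<dots> = ?D ^ N"
    unfolding \<beta> by (simp add: algebra_simps)
  finally show ?thesis
    unfolding braket_def output_state_GHZ K_def[symmetric] \<beta>_def[symmetric]
      complex_cnj_complex_of_real of_real_mult[symmetric] of_real_sum[symmetric]
      power2_eq_square[of "_ + _", symmetric]
    by (rule arg_cong)
qed

lemma sum_GHZ:
  "(\<Sum>x\<in>comp_basis (sys N). GHZ N \<alpha> x * f x)
    = complex_of_real \<alpha> * f (\<lambda>q\<in>sys N. False)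
      + complex_of_real (sqrt (1 - \<alpha>\<^sup>2)) * f (\<lambda>q\<in>sys N. True)"
proof -
  have "(\<Sum>x\<in>comp_basis (sys N). basis_ket (\<lambda>q\<in>sys N. t) x * f x) = f (\<lambda>q\<in>sys N. t)" for t
  proof -
    have "(\<lambda>q\<in>sys N. t) \<in> comp_basis (sys N)"
      by (auto simp: comp_basis_def)
    then show ?thesis
      by (simp add: basis_ket_def if_distrib[where f = "\<lambda>c. c * _"] cong: if_cong)
  qed
  then show ?thesis
    by (simp add: GHZ_def distrib_right sum.distrib mult.assoc sum_distrib_left[symmetric])
qed

lemma cnj_GHZ: "cnj (GHZ N \<alpha> x) = GHZ N \<alpha> x"
  by (simp add: GHZ_def basis_ket_def)

text \<open>Projecting the system part of \<open>\<psi>\<close> onto \<open>\<phi>\<close> leaves a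
  vector on \<open>E\<close>; the expectation value is its squared norm.\<close>

lemma expectation_partial_trace_ketbra:
  "braket Q \<phi> (apply_op Q (partial_trace Q E (ketbra \<psi> \<psi>)) \<phi>)
    = (\<Sum>z\<in>comp_basis E. (\<Sum>x\<in>comp_basis Q. cnj (\<phi> x) * \<psi> (merge Q E (x, z)))
        * cnj (\<Sum>x\<in>comp_basis Q. cnj (\<phi> x) * \<psi> (merge Q E (x, z))))"
proof -
  have "braket Q \<phi> (apply_op Q (partial_trace Q E (ketbra \<psi> \<psi>)) \<phi>)
    = (\<Sum>x\<in>comp_basis Q. \<Sum>y\<in>comp_basis Q. \<Sum>z\<in>comp_basis E.
        (cnj (\<phi> x) * \<psi> (merge Q E (x, z))) * (\<phi> y * cnj (\<psi> (merge Q E (y, z)))))"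
    unfolding braket_def apply_op_def partial_trace_def ketbra_def
    by (simp add: sum_distrib_left sum_distrib_right mult_ac)
  also have "\<dots> = (\<Sum>x\<in>comp_basis Q. \<Sum>z\<in>comp_basis E. \<Sum>y\<in>comp_basis Q.
        (cnj (\<phi> x) * \<psi> (merge Q E (x, z))) * (\<phi> y * cnj (\<psi> (merge Q E (y, z)))))"
    by (intro sum.cong refl sum.swap)
  also have "\<dots> = (\<Sum>z\<in>comp_basis E. \<Sum>x\<in>comp_basis Q. \<Sum>y\<in>comp_basis Q.
        (cnj (\<phi> x) * \<psi> (merge Q E (x, z))) * (\<phi> y * cnj (\<psi> (merge Q E (y, z)))))"
    by (rule sum.swap)
  finally show ?thesis
    by (simp add: sum_product)
qed

lemma overlap_output_GHZ:
  assumes "\<bar>\<alpha>\<bar> \<le> 1" "N \<ge> 1"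
  shows "braket (sys N) (GHZ N \<alpha>) (apply_op (sys N) (transmitted_state N R (GHZ N \<alpha>)) (GHZ N \<alpha>))
    = complex_of_real ((\<alpha>^4 + (1 - \<alpha>\<^sup>2)\<^sup>2) * ((2 - 6 * R + 5 * R\<^sup>2) / 2) ^ N
        + 2 * \<alpha>\<^sup>2 * (1 - \<alpha>\<^sup>2) * ((1 - 3 * R + 2 * R\<^sup>2) ^ N + (R\<^sup>2 / 2) ^ N))"
proof -
  define \<beta> where "\<beta> = sqrt (1 - \<alpha>\<^sup>2)"
  have \<beta>: "\<beta>\<^sup>2 = 1 - \<alpha>\<^sup>2"
    using assms by (simp add: \<beta>_def abs_square_le_1)
  \<comment> \<open>Here \<open>t\<close> is the common input bit of the branch and \<open>u\<close>
    the common output bit, and \<open>w\<close> collects the four combinations with their GHZ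
    amplitudes.\<close>
  define K where "K t u z = (\<Prod>j=1..N. kraus R t u (z (AncA j)) (z (AncB j)))" for t u z
  define w where "w z = \<alpha>\<^sup>2 * K False False z + \<alpha> * \<beta> * K True False z
      + \<alpha> * \<beta> * K False True z + \<beta>\<^sup>2 * K True True z" for z
  let ?Z = "comp_basis (anc N)"
  let ?A = "(2 - 6 * R + 5 * R\<^sup>2) / 2" and ?B = "1 - 3 * R + 2 * R\<^sup>2"
  have K_gram: "(\<Sum>z\<in>?Z. K t u z * K t' u' z)
      = (\<Sum>(a, b)\<in>UNIV. kraus R t u a b * kraus R t' u' a b) ^ N" for t u t' u'
    unfolding K_def prod.distrib[symmetric]
    by (rule sum_comp_basis_anc_prod[where f = "\<lambda>a b. kraus R t u a b * kraus R t' u' a b"])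
  \<comment> \<open>The ancilla bits \<open>(a, b)\<close> contain one 1 if the system bit is kept,
    none if it flips from 0 to 1, and two if it flips from 1 to 0. These outcomes are disjoint, so
    the mixed sums vanish.\<close>
  have kraus_gram: "(\<Sum>(a, b)\<in>UNIV. kraus R t t a b * kraus R t t a b) = ?A"
    "(\<Sum>(a, b)\<in>UNIV. kraus R False False a b * kraus R True True a b) = ?B"
    "(\<Sum>(a, b)\<in>UNIV. kraus R t (\<not> t) a b * kraus R t (\<not> t) a b) = R\<^sup>2 / 2"
    "(\<Sum>(a, b)\<in>UNIV. kraus R False True a b * kraus R True False a b) = 0"
    "(\<Sum>(a, b)\<in>UNIV. kraus R t t a b * kraus R u (\<not> u) a b) = 0" for t u
    unfolding sum_UNIV_bool_pair
    by (cases t; cases u; simp add: kraus_simps field_simps power2_eq_square)+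
  have gram: "(\<Sum>z\<in>?Z. K t t z * K t t z) = ?A ^ N"
    "(\<Sum>z\<in>?Z. K False False z * K True True z) = ?B ^ N"
    "(\<Sum>z\<in>?Z. K t (\<not> t) z * K t (\<not> t) z) = (R\<^sup>2 / 2) ^ N"
    "(\<Sum>z\<in>?Z. K False True z * K True False z) = 0"
    "(\<Sum>z\<in>?Z. K t t z * K u (\<not> u) z) = 0" for t u
    unfolding K_gram kraus_gram using assms(2) by simp_all
  have out: "output_state N R (GHZ N \<alpha>) (merge (sys N) (anc N) (\<lambda>q\<in>sys N. s, z))
     = complex_of_real (\<alpha> * K False s z + \<beta> * K True s z)" for s z
  proof -
    have "merge (sys N) (anc N) (\<lambda>q\<in>sys N. s, z) (Sys j) = s"
      "merge (sys N) (anc N) (\<lambda>q\<in>sys N. s, z) (AncA j) = z (AncA j)"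
      "merge (sys N) (anc N) (\<lambda>q\<in>sys N. s, z) (AncB j) = z (AncB j)" if "j \<in> {1..N}" for j
      using that by (auto simp: merge_def sys_def anc_def)
    then show ?thesis
      by (simp add: output_state_GHZ K_def \<beta>_def cong: prod.cong_simp)
  qed
  have "braket (sys N) (GHZ N \<alpha>) (apply_op (sys N) (transmitted_state N R (GHZ N \<alpha>)) (GHZ N \<alpha>))
     = (\<Sum>z\<in>?Z. complex_of_real (w z) * cnj (complex_of_real (w z)))"
    unfolding transmitted_state_def expectation_partial_trace_ketbra
      cnj_GHZ sum_GHZ out \<beta>_def[symmetric]
    by (simp add: w_def algebra_simps power2_eq_square)
  also have "\<dots> = complex_of_real (\<Sum>z\<in>?Z. w z * w z)"
    by simp
  \<comment> \<open>All ten products of the square of \<open>w z\<close>. Writing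
    \<open>\<not> False\<close> and \<open>\<not> True\<close> unevaluated lets the schematic
    equations of \<open>gram\<close> match under \<open>simp only\<close>.\<close>
  also have "(\<Sum>z\<in>?Z. w z * w z) = (\<Sum>z\<in>?Z.
        \<alpha>^4 * (K False False z * K False False z) + (\<beta>\<^sup>2)\<^sup>2 * (K True True z * K True True z)
      + 2 * \<alpha>\<^sup>2 * \<beta>\<^sup>2 * (K False False z * K True True z)
      + \<alpha>\<^sup>2 * \<beta>\<^sup>2 * (K False (\<not> False) z * K False (\<not> False) z)
      + \<alpha>\<^sup>2 * \<beta>\<^sup>2 * (K True (\<not> True) z * K True (\<not> True) z)
      + 2 * \<alpha>\<^sup>2 * \<beta>\<^sup>2 * (K False True z * K True False z)
      + 2 * \<alpha>^3 * \<beta> * (K False False z * K False (\<not> False) z)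
      + 2 * \<alpha>^3 * \<beta> * (K False False z * K True (\<not> True) z)
      + 2 * \<alpha> * \<beta>^3 * (K True True z * K False (\<not> False) z)
      + 2 * \<alpha> * \<beta>^3 * (K True True z * K True (\<not> True) z))"
    by (rule sum.cong) (simp_all add: w_def algebra_simps power2_eq_square power3_eq_cube power4_eq_xxxx)
  also have "\<dots> = (\<alpha>^4 + (\<beta>\<^sup>2)\<^sup>2) * ?A ^ N + 2 * \<alpha>\<^sup>2 * \<beta>\<^sup>2 * (?B ^ N + (R\<^sup>2 / 2) ^ N)"
    by (simp only: sum.distrib sum_distrib_left[symmetric] gram) (simp add: algebra_simps)
  finally show ?thesis
    unfolding \<beta> .
qed

section \<open>Closed form of the fidelity and degree of its numerator\<close>

lemma GHZ_fidelity_eq: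
  assumes "\<bar>\<alpha>\<bar> \<le> 1" "N \<ge> 1"
  shows "GHZ_fidelity N \<alpha> R =
    ((\<alpha>^4 + (1 - \<alpha>\<^sup>2)\<^sup>2) * ((2 - 6 * R + 5 * R\<^sup>2) / 2) ^ N
      + 2 * \<alpha>\<^sup>2 * (1 - \<alpha>\<^sup>2) * ((1 - 3 * R + 2 * R\<^sup>2) ^ N + (R\<^sup>2 / 2) ^ N))
    / (3 * R\<^sup>2 - 3 * R + 1) ^ N"
  unfolding GHZ_fidelity_def transmitted_fidelity_def norm_output_GHZ[OF assms]
    overlap_output_GHZ[OF assms] of_real_divide[symmetric] Re_complex_of_real ..

lemma success_factor_pos: "0 < 3 * R\<^sup>2 - 3 * R + (1 :: real)"
proof -
  have "3 * R\<^sup>2 - 3 * R + 1 = 3 * (R - 1 / 2)\<^sup>2 + 1 / 4"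
    by (simp add: field_simps power2_eq_square)
  also have "\<dots> > 0"
    by (simp add: add_nonneg_pos)
  finally show ?thesis .
qed

text \<open>The three powers have positive leading coefficients and positive weights
  \<open>p\<close> and \<open>q\<close>, so their terms of degree \<open>2 * N\<close> cannot
  cancel. Pulling 3 out of the denominator base produces the factor
  \<open>1 / 3 ^ N\<close>.\<close>

lemma GHZ_fidelity_poly:
  assumes "0 < \<alpha>" "\<alpha> < 1" "N \<ge> 1"
  shows "\<exists>P :: real poly. degree P = 2 * N \<and>
    (\<forall>R. GHZ_fidelity N \<alpha> R = poly P R / (R\<^sup>2 - R + 1/3) ^ N)"
proof -
  define p q where "p = \<alpha>^4 + (1 - \<alpha>\<^sup>2)\<^sup>2" and "q = 2 * \<alpha>\<^sup>2 * (1 - \<alpha>\<^sup>2)"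
  have "\<alpha>\<^sup>2 < 1"
    using assms by (simp add: power_less_one_iff)
  then have "p > 0" "q > 0"
    using assms by (auto simp: p_def q_def intro!: add_pos_nonneg)
  define S :: "real poly" where "S = smult p ([:1, -3, 5/2:] ^ N)
    + smult q ([:1, -3, 2:] ^ N) + smult q ([:0, 0, 1/2:] ^ N)"
  have deg: "degree ([:a, b, c:] ^ N) \<le> 2 * N" for a b c :: real
    by (rule order.trans[OF degree_power_le]) auto
  have coeff: "coeff ([:a, b, c:] ^ N) (2 * N) = c ^ N" if "c \<noteq> 0" for a b c :: real
  proof -
    have "lead_coeff ([:a, b, c:] ^ N) = c ^ N"
      by (subst lead_coeff_power) (use that in simp)
    moreover have "degree ([:a, b, c:] ^ N) = 2 * N"
      using that by (simp add: degree_power_eq)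
    ultimately show ?thesis
      by metis
  qed
  have "degree S \<le> 2 * N"
    unfolding S_def by (intro degree_add_le order.trans[OF degree_smult_le] deg)
  moreover have "coeff S (2 * N) > 0"
    using \<open>p > 0\<close> \<open>q > 0\<close> by (simp add: S_def coeff add_pos_pos)
  ultimately have "degree S = 2 * N"
    by (intro antisym le_degree) auto
  moreover have "GHZ_fidelity N \<alpha> R = poly (smult (1 / 3 ^ N) S) R / (R\<^sup>2 - R + 1/3) ^ N" for R
  proof -
    have D: "3 * R\<^sup>2 - 3 * R + 1 = 3 * (R\<^sup>2 - R + 1/3)"
      by simp
    have polyS: "poly S R = p * ((2 - 6 * R + 5 * R\<^sup>2) / 2) ^ N
      + q * ((1 - 3 * R + 2 * R\<^sup>2) ^ N + (R\<^sup>2 / 2) ^ N)"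
      by (simp add: S_def algebra_simps power2_eq_square diff_divide_distrib add_divide_distrib)
    have \<alpha>: "\<bar>\<alpha>\<bar> \<le> 1"
      using assms by simp
    show ?thesis
      unfolding GHZ_fidelity_eq[OF \<alpha> assms(3)] D power_mult_distrib poly_smult polyS p_def q_def
      by simp
  qed
  ultimately show ?thesis
    by (intro exI[of _ "smult (1 / 3 ^ N) S"]) simp
qed

section \<open>Exponential decay\<close>

lemma power_quotient_tendsto:
  fixes x c :: real
  assumes "c > 0" "\<bar>x\<bar> < c \<or> x = c"
  shows "(\<lambda>N. x ^ N / c ^ N) \<longlonglongrightarrow> of_bool (x = c)"
proof (cases "x = c")
  case False
  then have "\<bar>x / c\<bar> < 1"
    using assms by auto
  then show ?thesis
    using False LIMSEQ_abs_realpow_zero2[of "x / c"] by (simp add: power_divide)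
qed (use assms in simp)

definition decay_factor :: "real \<Rightarrow> real" where
  "decay_factor R = max ((2 - 6 * R + 5 * R\<^sup>2) / 2) (R\<^sup>2 / 2) / (3 * R\<^sup>2 - 3 * R + 1)"

lemma GHZ_fidelity_asymp:
  assumes "0 < \<alpha>" "\<alpha> < 1"
  shows "\<exists>C>0. (\<lambda>N. GHZ_fidelity N \<alpha> R) \<sim>[at_top] (\<lambda>N. C * decay_factor R ^ N)"
proof -
  define p q where "p = \<alpha>^4 + (1 - \<alpha>\<^sup>2)\<^sup>2" and "q = 2 * \<alpha>\<^sup>2 * (1 - \<alpha>\<^sup>2)"
  have "\<alpha>\<^sup>2 < 1"
    using assms by (simp add: power_less_one_iff)
  then have "p > 0" "q > 0"
    using assms by (auto simp: p_def q_def intro!: add_pos_nonneg)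
  define A B T D where "A = (2 - 6 * R + 5 * R\<^sup>2) / 2" and "B = 1 - 3 * R + 2 * R\<^sup>2"
    and "T = R\<^sup>2 / 2" and "D = 3 * R\<^sup>2 - 3 * R + 1"
  define m where "m = max A T"
  have "D > 0"
    unfolding D_def by (rule success_factor_pos)
  have AT: "A = T + B"
    by (simp add: A_def B_def T_def field_simps)
  \<comment> \<open>Together with \<open>A - B = T \<ge> 0\<close> this square yields
    \<open>\<bar>B\<bar> \<le> A\<close>.\<close>
  have "A + B = (2 - 3 * R)\<^sup>2 / 2"
    by (simp add: A_def B_def power2_eq_square field_simps)
  then have AB: "A + B \<ge> 0"
    by (simp only: zero_le_power2 zero_le_divide_iff) simp
  have "T \<ge> 0"
    by (simp add: T_def)
  have "m > 0"
    using AB \<open>T \<ge> 0\<close> unfolding m_def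
    by (cases "R = 0") (auto simp: A_def T_def less_max_iff_disj)
  \<comment> \<open>The value \<open>- m\<close> must be excluded, as the quotients would oscillate.
    For \<open>B = - m\<close> one would get \<open>A = m\<close> and hence
    \<open>T = A - B = 2 * m > m\<close>.\<close>
  have "\<bar>A\<bar> < m \<or> A = m" "\<bar>B\<bar> < m \<or> B = m" "\<bar>T\<bar> < m \<or> T = m"
    using AT AB \<open>T \<ge> 0\<close> \<open>m > 0\<close> unfolding m_def by linarith+
  note lims = this[THEN power_quotient_tendsto[OF \<open>m > 0\<close>]]
  \<comment> \<open>Several bases may attain the maximum at once: \<open>A\<close> and
    \<open>B\<close> at \<open>R = 0\<close>, \<open>A\<close> and \<open>T\<close> at
    \<open>R = 1 / 2\<close>. Each contributes its weight to the limit.\<close>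
  define C :: real where "C = p * of_bool (A = m) + q * (of_bool (B = m) + of_bool (T = m))"
  have "A = m \<or> T = m"
    by (auto simp: m_def max_def)
  then have "C > 0"
    using \<open>p > 0\<close> \<open>q > 0\<close> by (auto simp: C_def add_pos_pos add_pos_nonneg)
  have "(\<lambda>N. p * (A ^ N / m ^ N) + q * (B ^ N / m ^ N + T ^ N / m ^ N)) \<longlonglongrightarrow> C"
    unfolding C_def by (intro tendsto_intros lims)
  then have "(\<lambda>N. (p * (A ^ N / m ^ N) + q * (B ^ N / m ^ N + T ^ N / m ^ N)) / C) \<longlonglongrightarrow> C / C"
    by (intro tendsto_divide tendsto_const) (use \<open>C > 0\<close> in auto)
  moreover have "eventually (\<lambda>N. (p * (A ^ N / m ^ N) + q * (B ^ N / m ^ N + T ^ N / m ^ N)) / C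
      = GHZ_fidelity N \<alpha> R / (C * decay_factor R ^ N)) sequentially"
    \<comment> \<open>The closed form is available from \<open>N = 1\<close> on.\<close>
    using eventually_ge_at_top[of 1]
  proof eventually_elim
    case (elim N)
    have fid: "GHZ_fidelity N \<alpha> R = (p * A ^ N + q * (B ^ N + T ^ N)) / D ^ N"
      using assms elim by (simp add: GHZ_fidelity_eq p_def q_def A_def B_def T_def D_def)
    have dec: "decay_factor R = m / D"
      by (simp add: decay_factor_def m_def A_def T_def D_def)
    show ?case
      unfolding fid dec using \<open>D > 0\<close> \<open>m > 0\<close> \<open>C > 0\<close> by (simp add: field_simps power_divide)
  qed
  ultimately have "(\<lambda>N. GHZ_fidelity N \<alpha> R / (C * decay_factor R ^ N)) \<longlonglongrightarrow> 1"
    using \<open>C > 0\<close> by (simp add: filterlim_cong)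
  then show ?thesis
    using \<open>C > 0\<close> by (intro exI[of _ C] conjI asymp_equivI') auto
qed

text \<open>Both candidate bases lie strictly below the denominator \<open>?D\<close>: the gap to
  the diagonal one is \<open>R\<^sup>2 / 2\<close>, and the gap to \<open>R\<^sup>2 / 2\<close> is a
  positive quadratic, seen by completing the square.\<close>

lemma decay_factor_bounds:
  assumes "R \<noteq> 0"
  shows "0 < decay_factor R" "decay_factor R < 1"
proof -
  let ?D = "3 * R\<^sup>2 - 3 * R + 1"
  have "R\<^sup>2 > 0"
    using assms by simp
  then show "0 < decay_factor R"
    by (auto simp: decay_factor_def less_max_iff_disj success_factor_pos)
  have "?D - R\<^sup>2 / 2 = 5 / 2 * (R - 3 / 5)\<^sup>2 + 1 / 10"
    by (simp add: field_simps power2_eq_square)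
  also have "\<dots> > 0"
    by (simp add: add_nonneg_pos)
  finally have "R\<^sup>2 / 2 < ?D"
    by simp
  moreover have "(2 - 6 * R + 5 * R\<^sup>2) / 2 < ?D"
    using \<open>R\<^sup>2 > 0\<close> by (simp add: field_simps)
  ultimately show "decay_factor R < 1"
    by (simp add: decay_factor_def success_factor_pos)
qed

lemma decay_factor_0: "decay_factor 0 = 1" and decay_factor_half: "decay_factor (1/2) = 1/2"
  by (simp_all add: decay_factor_def power2_eq_square)

text \<open>The prefactor \<open>C\<close> may depend on \<open>\<alpha>\<close> and
  \<open>R\<close> but not on \<open>N\<close>, so the asymptotic equivalence determines
  \<open>c R\<close> uniquely on \<open>{0..1}\<close>; that \<open>c\<close> is the same for all
  \<open>\<alpha>\<close> is part of the claim.\<close>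

theorem theorem1:
  shows
    "(\<forall>N\<ge>1. \<forall>\<alpha>\<in>{0<..<1}. \<exists>P :: real poly. degree P = 2 * N \<and>
        (\<forall>R\<in>{0..1}. GHZ_fidelity N \<alpha> R = poly P R / (R\<^sup>2 - R + 1/3) ^ N)) \<and>
     (\<exists>c :: real \<Rightarrow> real.
        (\<forall>\<alpha>\<in>{0<..<1}. \<forall>R\<in>{0..1}. \<exists>C>0.
           (\<lambda>N. GHZ_fidelity N \<alpha> R) \<sim>[at_top] (\<lambda>N. C * c R ^ N)) \<and>
        (\<forall>R\<in>{0<..1}. 0 < c R \<and> c R < 1) \<and>
        c 0 = 1 \<and> c (1/2) = 1/2)"
proof (intro conjI allI impI ballI exI[of _ decay_factor])
  fix N :: nat and \<alpha> :: real
  assume "1 \<le> N" "\<alpha> \<in> {0<..<1}"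
  then show "\<exists>P :: real poly. degree P = 2 * N \<and>
      (\<forall>R\<in>{0..1}. GHZ_fidelity N \<alpha> R = poly P R / (R\<^sup>2 - R + 1/3) ^ N)"
    using GHZ_fidelity_poly[of \<alpha> N] by auto
qed (use GHZ_fidelity_asymp decay_factor_bounds decay_factor_0 decay_factor_half in auto)

end
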